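(* Consider the identical machine scheduling problem: a set $M$ of $m$ identical machines, a finite set $J$ of jobs with sizes $p_j>0$; an allocation $\sigma:J\to M$ has cost $\sum_{i\in M}\theta\big(p(\sigma^{-1}(i))\big)$, where $p(S)=\sum_{j\in S}p_j$. Assume \[ \alpha:=\sup_{t\in(0,1);\ d\ge0;\ r\ge \frac{d}{1-t}}\ \frac{t\,\theta(r+d)+(1-t)\,\theta(d)}{t\,\theta(r)+(1-t)\,\theta\!\left(\frac{d}{1-t}\right)}<\infty. \] If $\sigma$ is an EF1 allocation, then the cost of $\sigma$ is at most $\alpha$ times the minimum cost over all allocations.
   Context: $\theta:\mathbb{R}_{\ge0}\to\mathbb{R}_{\ge0}$ is increasing and convex with $\theta(0)=0$, with continuous first and second derivatives. An allocation $\sigma:J\to M$ is EF1 (envy-free up to one item, interpreting jobs as goods) if for every two machines $i,i'\in M$, $p(\sigma^{-1}(i))\ge p(\sigma^{-1}(i'))-\max\{p_j: j\in\sigma^{-1}(i')\}$ (the max is $0$ if $\sigma^{-1}(i')$ is empty). *)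

theory Defs
  imports "HOL-Analysis.Analysis"
begin

definition cost_function :: "(real \<Rightarrow> real) \<Rightarrow> bool" where
  "cost_function \<theta> \<longleftrightarrow>
     (\<forall>x\<ge>0. 0 \<le> \<theta> x) \<and> \<theta> 0 = 0 \<and> mono_on {0..} \<theta> \<and> convex_on {0..} \<theta> \<and>
     (\<exists>\<theta>' \<theta>''.
        (\<forall>x\<ge>0. (\<theta> has_real_derivative \<theta>' x) (at x within {0..})) \<and>
        (\<forall>x\<ge>0. (\<theta>' has_real_derivative \<theta>'' x) (at x within {0..})) \<and>
        continuous_on {0..} \<theta>' \<and> continuous_on {0..} \<theta>'')"

definition allocations :: "'j set \<Rightarrow> 'm set \<Rightarrow> ('j \<Rightarrow> 'm) set" where
  "allocations J M = J \<rightarrow>\<^sub>E M"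

definition jobs_on :: "'j set \<Rightarrow> ('j \<Rightarrow> 'm) \<Rightarrow> 'm \<Rightarrow> 'j set" where
  "jobs_on J \<sigma> i = {j \<in> J. \<sigma> j = i}"

definition load :: "'j set \<Rightarrow> ('j \<Rightarrow> real) \<Rightarrow> ('j \<Rightarrow> 'm) \<Rightarrow> 'm \<Rightarrow> real" where
  "load J p \<sigma> i = (\<Sum>j\<in>jobs_on J \<sigma> i. p j)"

definition max_job :: "'j set \<Rightarrow> ('j \<Rightarrow> real) \<Rightarrow> ('j \<Rightarrow> 'm) \<Rightarrow> 'm \<Rightarrow> real" where
  "max_job J p \<sigma> i =
     (if jobs_on J \<sigma> i = {} then 0 else Max (p ` jobs_on J \<sigma> i))"

definition cost ::
  "(real \<Rightarrow> real) \<Rightarrow> 'j set \<Rightarrow> 'm set \<Rightarrow> ('j \<Rightarrow> real) \<Rightarrow> ('j \<Rightarrow> 'm) \<Rightarrow> real" where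
  "cost \<theta> J M p \<sigma> = (\<Sum>i\<in>M. \<theta> (load J p \<sigma> i))"

definition min_cost ::
  "(real \<Rightarrow> real) \<Rightarrow> 'j set \<Rightarrow> 'm set \<Rightarrow> ('j \<Rightarrow> real) \<Rightarrow> real" where
  "min_cost \<theta> J M p = Min (cost \<theta> J M p ` allocations J M)"

definition EF1 :: "'j set \<Rightarrow> 'm set \<Rightarrow> ('j \<Rightarrow> real) \<Rightarrow> ('j \<Rightarrow> 'm) \<Rightarrow> bool" where
  "EF1 J M p \<sigma> \<longleftrightarrow>
     (\<forall>i\<in>M. \<forall>i'\<in>M. load J p \<sigma> i \<ge> load J p \<sigma> i' - max_job J p \<sigma> i')"

text \<open>
  The quotient is taken in \<^typ>\<open>ennreal\<close>, so a positive numerator over a vanishing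
  denominator counts as infinity instead of being discarded as in \<^typ>\<open>real\<close>.
  The indeterminate case (e.g. \<open>d = r = 0\<close>) has value 0 and so does not affect the supremum.
\<close>

definition ef1_ratio :: "(real \<Rightarrow> real) \<Rightarrow> ennreal" where
  "ef1_ratio \<theta> =
     (SUP (t, d, r) \<in> {(t, d, r). 0 < t \<and> t < 1 \<and> 0 \<le> d \<and> d / (1 - t) \<le> r}.
        ennreal (t * \<theta> (r + d) + (1 - t) * \<theta> d) /
        ennreal (t * \<theta> r + (1 - t) * \<theta> (d / (1 - t))))"

end

theory Submission
  imports Defs
begin

text \<open>
  Write \<open>l\<^sub>i\<close> for the load and \<open>q\<^sub>i\<close> for the largest job of machine \<open>i\<close> under \<open>\<sigma>\<close>, and
  \<open>d\<close> for the smallest load, so that EF1 gives \<open>d \<le> l\<^sub>i \<le> q\<^sub>i + d\<close>. Treating all jobs other than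
  the \<open>q\<^sub>i\<close> as sand, choose the water level \<open>w\<close> with total \<open>r\<^sub>i = max q\<^sub>i w\<close> equal to total
  load. Every allocation costs at least \<open>\<Sum>i. \<theta> r\<^sub>i\<close>: subtract from \<open>\<theta>\<close> its tangent at \<open>w\<close>,
  which does not affect the comparison because the totals agree; the remainder, set to 0
  below \<open>w\<close>, is superadditive.

  On the other side, if \<open>0 < d < w\<close>, convexity and the definition of \<open>\<alpha>\<close> with \<open>1 - t = d / w\<close>
  yield on each machine separately
  \<open>\<theta> l\<^sub>i \<le> \<alpha> * \<theta> r\<^sub>i + (l\<^sub>i - r\<^sub>i) / (w - d) * (\<alpha> * \<theta> w - \<theta> d)\<close>,
  and the last terms sum to zero. In the remaining cases \<open>l\<^sub>i = r\<^sub>i\<close> for all \<open>i\<close>.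
\<close>

section \<open>From the extended-real supremum to a real inequality\<close>

text \<open>Multiplying out the denominator also covers a vanishing one: a positive numerator over 0
  would be \<open>top\<close>, against finiteness of the supremum, so both sides are 0
  there.\<close>

lemma ef1_ratio_bound:
  assumes nonneg: "\<And>x. 0 \<le> x \<Longrightarrow> 0 \<le> \<theta> x" and fin: "ef1_ratio \<theta> < \<infinity>"
    and t: "0 < t" "t < 1" and d: "0 \<le> d" "d / (1 - t) \<le> r"
  shows "t * \<theta> (r + d) + (1 - t) * \<theta> d
           \<le> enn2real (ef1_ratio \<theta>) * (t * \<theta> r + (1 - t) * \<theta> (d / (1 - t)))"
    (is "?n \<le> ?\<alpha> * ?d")
proof -
  have "0 \<le> d / (1 - t)" using t d by simp
  hence r: "0 \<le> r" using d by linarith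
  have n: "0 \<le> ?n" using t d r by (intro add_nonneg_nonneg mult_nonneg_nonneg nonneg) auto
  have dn: "0 \<le> ?d"
    using t r \<open>0 \<le> d / (1 - t)\<close> by (intro add_nonneg_nonneg mult_nonneg_nonneg nonneg) auto
  have "ennreal ?n / ennreal ?d \<le> ef1_ratio \<theta>"
    unfolding ef1_ratio_def by (rule SUP_upper2[where i = "(t, d, r)"]) (use t d in auto)
  also have alpha: "ef1_ratio \<theta> = ennreal ?\<alpha>" using fin by simp
  finally have le: "ennreal ?n / ennreal ?d \<le> ennreal ?\<alpha>" .
  show ?thesis
  proof (cases "?d = 0")
    case True
    have "?n = 0"
    proof (rule ccontr)
      assume "?n \<noteq> 0"
      hence "ennreal ?n / ennreal ?d = top" using True n by (simp add: ennreal_divide_zero)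
      thus False using le by (simp add: top_unique)
    qed
    thus ?thesis using True by simp
  next
    case False
    hence "0 < ?d" using dn by simp
    hence "?n / ?d \<le> ?\<alpha>" using le n by (simp add: divide_ennreal)
    thus ?thesis using \<open>0 < ?d\<close> by (simp add: pos_divide_le_eq)
  qed
qed

section \<open>Convexity and superadditivity\<close>

lemma superadditive_sum_le:
  fixes \<psi> :: "real \<Rightarrow> real"
  assumes "finite S" and "\<psi> 0 = 0"
    and "\<And>x y. 0 \<le> x \<Longrightarrow> 0 \<le> y \<Longrightarrow> \<psi> x + \<psi> y \<le> \<psi> (x + y)"
    and "\<And>j. j \<in> S \<Longrightarrow> 0 \<le> p j"
  shows "(\<Sum>j\<in>S. \<psi> (p j)) \<le> \<psi> (\<Sum>j\<in>S. p j)"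
  using assms(1,4)
proof (induction S rule: finite_induct)
  case empty
  thus ?case by (simp add: assms(2))
next
  case (insert a S)
  have "\<psi> (p a) + \<psi> (sum p S) \<le> \<psi> (p a + sum p S)"
    by (rule assms(3)) (auto intro: sum_nonneg insert.prems)
  with insert show ?case by simp
qed

lemma convex_combination_le:
  fixes f :: "real \<Rightarrow> real"
  assumes "convex_on S f" and "x \<in> S" "y \<in> S" and "0 \<le> u" "u \<le> 1"
  shows "f (u * x + (1 - u) * y) \<le> u * f x + (1 - u) * f y"
  using convex_onD[OF assms(1), of u y x] assms by (simp add: algebra_simps)

text \<open>The quotient \<open>f (max z w) / z\<close> is nondecreasing in \<open>z > 0\<close>.
  This is \<open>scale\<close> in cross-multiplied form; adding its instances for \<open>x\<close>
  and \<open>y\<close> against \<open>s = x + y\<close> gives the claim.\<close>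

lemma convex_excess_superadditive:
  fixes f :: "real \<Rightarrow> real"
  assumes conv: "convex_on {0..} f" and nonneg: "\<And>x. 0 \<le> x \<Longrightarrow> 0 \<le> f x"
    and w: "0 \<le> w" "f w = 0" and x: "0 \<le> x" and y: "0 \<le> y"
  shows "f (max x w) + f (max y w) \<le> f (max (x + y) w)"
proof -
  have scale: "f (max z w) * s \<le> z * f (max s w)" if z: "0 \<le> z" "z \<le> s" for z s
  proof (cases "z \<le> w")
    case True
    thus ?thesis using w z nonneg[of "max s w"] by (simp add: max_def)
  next
    case False
    \<comment> \<open>Position of \<open>z\<close> between \<open>w\<close> and \<open>s\<close>:
      convexity with \<open>f w = 0\<close> gives \<open>f z \<le> u * f s\<close>, and
      \<open>u * s \<le> z\<close> because \<open>w \<ge> 0\<close>.\<close>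
    define u where "u = (z - w) / (s - w)"
    have u: "0 \<le> u" "u \<le> 1" using False z by (auto simp: u_def)
    have "u * (s - w) = z - w" using False z by (simp add: u_def)
    hence zu: "z = u * s + (1 - u) * w" by (simp add: algebra_simps)
    have us: "u * s \<le> z" using zu u w by (simp add: mult_nonneg_nonneg)
    have "f z \<le> u * f s + (1 - u) * f w"
      using convex_combination_le[OF conv, of s w u] u zu z w by simp
    hence "f z * s \<le> (u * f s) * s" using w z by (intro mult_right_mono) auto
    also have "\<dots> \<le> z * f s"
      using mult_right_mono[OF us nonneg[of s]] z by (simp add: ac_simps)
    finally show ?thesis using False z by (simp add: max_def)
  qed
  show ?thesis
  proof (cases "x + y = 0")
    case True
    hence "x = 0" "y = 0" using x y by auto
    thus ?thesis using w by simp
  next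
    case False
    hence "0 < x + y" using x y by simp
    moreover have "(f (max x w) + f (max y w)) * (x + y) \<le> f (max (x + y) w) * (x + y)"
      using scale[of x "x + y"] scale[of y "x + y"] x y by (simp add: algebra_simps)
    ultimately show ?thesis by simp
  qed
qed

section \<open>Loads and largest jobs\<close>

lemma load_nonneg:
  assumes "\<forall>j\<in>J. 0 < p j"
  shows "0 \<le> load J p \<sigma> i"
  unfolding load_def jobs_on_def using assms by (intro sum_nonneg) (auto simp: less_imp_le)

lemma max_job_attained:
  assumes "finite J" and "jobs_on J \<sigma> i \<noteq> {}"
  obtains j where "j \<in> jobs_on J \<sigma> i" "max_job J p \<sigma> i = p j"
proof -
  have "Max (p ` jobs_on J \<sigma> i) \<in> p ` jobs_on J \<sigma> i"
    using assms by (intro Max_in) (auto simp: jobs_on_def)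
  thus ?thesis using assms(2) that by (auto simp: max_job_def)
qed

lemma max_job_nonneg_le_load:
  assumes "finite J" and "\<forall>j\<in>J. 0 < p j"
  shows "0 \<le> max_job J p \<sigma> i" and "max_job J p \<sigma> i \<le> load J p \<sigma> i"
proof -
  have fin: "finite (jobs_on J \<sigma> i)" using assms(1) by (simp add: jobs_on_def)
  have "0 \<le> max_job J p \<sigma> i \<and> max_job J p \<sigma> i \<le> load J p \<sigma> i"
  proof (cases "jobs_on J \<sigma> i = {}")
    case True
    thus ?thesis by (simp add: max_job_def load_def)
  next
    case False
    then obtain j where j: "j \<in> jobs_on J \<sigma> i" "max_job J p \<sigma> i = p j"
      by (rule max_job_attained[OF assms(1)])
    have "p j \<le> load J p \<sigma> i" unfolding load_def
      using fin j assms(2) by (intro member_le_sum) (auto simp: jobs_on_def less_imp_le)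
    thus ?thesis using j assms(2) by (auto simp: jobs_on_def less_imp_le)
  qed
  thus "0 \<le> max_job J p \<sigma> i" and "max_job J p \<sigma> i \<le> load J p \<sigma> i" by auto
qed

lemma sum_jobs_on:
  assumes "finite J" "finite M" and "\<sigma> \<in> allocations J M"
  shows "(\<Sum>i\<in>M. \<Sum>j\<in>jobs_on J \<sigma> i. f j) = (\<Sum>j\<in>J. f j)"
  unfolding jobs_on_def using assms by (intro sum.group) (auto simp: allocations_def)

text \<open>The largest jobs of different machines are different jobs, so the left side is a subsum
  of the right. \<open>\<psi> 0 = 0\<close> handles empty machines, whose \<open>max_job\<close> is
  0 by convention.\<close>

lemma sum_max_job_le:
  fixes \<psi> :: "real \<Rightarrow> real"
  assumes J: "finite J" "finite M" and "\<sigma> \<in> allocations J M"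
    and "\<And>j. j \<in> J \<Longrightarrow> 0 \<le> \<psi> (p j)" and "\<psi> 0 = 0"
  shows "(\<Sum>i\<in>M. \<psi> (max_job J p \<sigma> i)) \<le> (\<Sum>j\<in>J. \<psi> (p j))"
proof -
  have "\<psi> (max_job J p \<sigma> i) \<le> (\<Sum>j\<in>jobs_on J \<sigma> i. \<psi> (p j))" for i
  proof (cases "jobs_on J \<sigma> i = {}")
    case True
    thus ?thesis by (simp add: max_job_def assms)
  next
    case False
    have fin: "finite (jobs_on J \<sigma> i)" using J by (simp add: jobs_on_def)
    obtain j where j: "j \<in> jobs_on J \<sigma> i" "max_job J p \<sigma> i = p j"
      using max_job_attained[OF J(1) False] .
    have "\<psi> (p j) \<le> (\<Sum>j\<in>jobs_on J \<sigma> i. \<psi> (p j))"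
      using fin j assms(4) by (intro member_le_sum) (auto simp: jobs_on_def)
    thus ?thesis using j by simp
  qed
  hence "(\<Sum>i\<in>M. \<psi> (max_job J p \<sigma> i)) \<le> (\<Sum>i\<in>M. \<Sum>j\<in>jobs_on J \<sigma> i. \<psi> (p j))"
    by (rule sum_mono)
  also have "\<dots> = (\<Sum>j\<in>J. \<psi> (p j))" using assms by (intro sum_jobs_on)
  finally show ?thesis .
qed

section \<open>Lower bound on the cost of every allocation\<close>

lemma cost_ge_water_filling:
  assumes cost: "cost_function \<theta>" and fin: "finite M" "finite J"
    and pos: "\<forall>j\<in>J. 0 < p j"
    and alloc: "\<sigma> \<in> allocations J M" "\<tau> \<in> allocations J M"
    and w: "0 \<le> w" "(\<Sum>i\<in>M. max (max_job J p \<sigma> i) w) = (\<Sum>j\<in>J. p j)"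
  shows "(\<Sum>i\<in>M. \<theta> (max (max_job J p \<sigma> i) w)) \<le> cost \<theta> J M p \<tau>"
proof -
  have conv: "convex_on {0..} \<theta>" using cost by (simp add: cost_function_def)
  \<comment> \<open>\<open>c\<close> is the slope of a supporting line at \<open>w\<close>: the
    derivative if \<open>w > 0\<close>, and 0 if \<open>w = 0\<close>, where \<open>\<theta>\<close>
    attains its minimum 0.\<close>
  obtain c where c: "\<And>x. 0 \<le> x \<Longrightarrow> c * (x - w) \<le> \<theta> x - \<theta> w"
  proof (cases "w = 0")
    \<comment> \<open>The library's tangent inequality only covers interior points.\<close>
    case True
    thus ?thesis using cost that[of 0] by (simp add: cost_function_def)
  next
    case False
    obtain c where "(\<theta> has_real_derivative c) (at w within {0..})"
      using cost w unfolding cost_function_def by auto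
    thus ?thesis using convex_on_imp_above_tangent[OF conv, of w _ c] that[of c] False w by simp
  qed
  define \<phi> where "\<phi> x = \<theta> x + (- c * x + (c * w - \<theta> w))" for x
  have \<phi>_nonneg: "0 \<le> \<phi> x" if "0 \<le> x" for x
    using c[OF that] by (simp add: \<phi>_def algebra_simps)
  have \<phi>_conv: "convex_on {0..} \<phi>"
    unfolding \<phi>_def
    by (intro convex_on_add conv) (auto intro!: convex_onI simp: algebra_simps)
  have \<phi>_w: "\<phi> w = 0" by (simp add: \<phi>_def)
  \<comment> \<open>\<open>\<phi> 0\<close> may be positive, which rules out superadditivity of
    \<open>\<phi>\<close>; flattening it to 0 below \<open>w\<close> repairs this and keeps the
    values at all \<open>max q w\<close>.\<close>
  define \<psi> where "\<psi> x = \<phi> (max x w)" for x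
  have \<psi>0: "\<psi> 0 = 0" using w \<phi>_w by (simp add: \<psi>_def)
  have \<psi>_nonneg: "0 \<le> \<psi> x" for x using w by (simp add: \<psi>_def \<phi>_nonneg)
  have \<psi>_le: "\<psi> x \<le> \<phi> x" if "0 \<le> x" for x
    using \<phi>_nonneg[OF that] \<phi>_w by (auto simp: \<psi>_def max_def)
  have \<psi>_super: "\<psi> x + \<psi> y \<le> \<psi> (x + y)" if "0 \<le> x" "0 \<le> y" for x y
    unfolding \<psi>_def using \<phi>_conv \<phi>_nonneg w(1) \<phi>_w that by (rule convex_excess_superadditive)
  \<comment> \<open>The affine correction contributes an amount fixed by the total load and the
    number of machines.\<close>
  have shift: "(\<Sum>i\<in>M. \<phi> (x i)) = (\<Sum>i\<in>M. \<theta> (x i)) - c * (\<Sum>j\<in>J. p j) + card M * (c * w - \<theta> w)"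
    if "(\<Sum>i\<in>M. x i) = (\<Sum>j\<in>J. p j)" for x
    unfolding that[symmetric] by (simp add: \<phi>_def sum.distrib sum_subtractf sum_negf sum_distrib_left)
  have "(\<Sum>i\<in>M. \<phi> (max (max_job J p \<sigma> i) w)) \<le> (\<Sum>j\<in>J. \<psi> (p j))"
    using sum_max_job_le[of J M \<sigma> \<psi> p] fin alloc \<psi>0 \<psi>_nonneg by (simp add: \<psi>_def)
  also have "\<dots> = (\<Sum>i\<in>M. \<Sum>j\<in>jobs_on J \<tau> i. \<psi> (p j))"
    using fin alloc by (intro sum_jobs_on[symmetric])
  also have "\<dots> \<le> (\<Sum>i\<in>M. \<psi> (load J p \<tau> i))"
    unfolding load_def using fin pos
    by (intro sum_mono superadditive_sum_le \<psi>0 \<psi>_super) (auto simp: jobs_on_def less_imp_le)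
  also have "\<dots> \<le> (\<Sum>i\<in>M. \<phi> (load J p \<tau> i))"
    by (intro sum_mono \<psi>_le load_nonneg pos)
  finally have "(\<Sum>i\<in>M. \<phi> (max (max_job J p \<sigma> i) w)) \<le> (\<Sum>i\<in>M. \<phi> (load J p \<tau> i))" .
  moreover have "(\<Sum>i\<in>M. load J p \<tau> i) = (\<Sum>j\<in>J. p j)"
    unfolding load_def using fin alloc by (intro sum_jobs_on)
  ultimately show ?thesis
    using shift[OF w(2)] shift[of "load J p \<tau>"] by (simp add: cost_def)
qed

text \<open>Intermediate value theorem on \<open>{0..S}\<close>: level 0 gives at most
  \<open>S\<close>, and at level \<open>S\<close> a single machine already contributes at least
  \<open>S\<close>.\<close>

lemma water_level_exists:
  fixes q :: "'a \<Rightarrow> real"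
  assumes M: "finite M" "M \<noteq> {}" and q: "\<And>i. i \<in> M \<Longrightarrow> 0 \<le> q i" and S: "(\<Sum>i\<in>M. q i) \<le> S"
  obtains w where "0 \<le> w" "(\<Sum>i\<in>M. max (q i) w) = S"
proof -
  let ?f = "\<lambda>w. \<Sum>i\<in>M. max (q i) w"
  have S0: "0 \<le> S" using S sum_nonneg[of M q] q by force
  have "?f 0 = (\<Sum>i\<in>M. q i)" using q by (intro sum.cong) auto
  hence "?f 0 \<le> S" using S by simp
  moreover have "S \<le> ?f S"
  proof -
    obtain a where a: "a \<in> M" using M by auto
    have "S \<le> max (q a) S" by simp
    also have "\<dots> \<le> ?f S" using a M S0 by (intro member_le_sum) auto
    finally show ?thesis .
  qed
  moreover have "continuous_on {0..S} ?f" by (intro continuous_intros)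
  ultimately show ?thesis using IVT'[of ?f 0 S S] S0 that by auto
qed

section \<open>Upper bound on the cost of an EF1 allocation\<close>

text \<open>For fixed \<open>q\<close> the right side is affine in \<open>l\<close>, so by convexity
  of \<open>\<theta>\<close> it suffices to check the ends of an interval containing
  \<open>l\<close>. This is \<open>[q, q + d]\<close> if \<open>w \<le> q\<close>, and
  \<open>[d, w + d]\<close> otherwise.\<close>

lemma machine_cost_le:
  fixes \<theta> :: "real \<Rightarrow> real"
  assumes conv: "convex_on {0..} \<theta>" and dw: "0 < d" "d < w"
    and ratio: "\<And>r. w \<le> r \<Longrightarrow> (w - d) * \<theta> (r + d) + d * \<theta> d \<le> \<alpha> * ((w - d) * \<theta> r + d * \<theta> w)"
    and \<alpha>: "\<And>x. 0 \<le> x \<Longrightarrow> \<theta> x \<le> \<alpha> * \<theta> x"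
    and q: "0 \<le> q" "q \<le> l" "l \<le> q + d" "d \<le> l"
  shows "\<theta> l \<le> \<alpha> * \<theta> (max q w) + (l - max q w) / (w - d) * (\<alpha> * \<theta> w - \<theta> d)"
proof -
  define \<kappa> where "\<kappa> = d / (w - d)"
  \<comment> \<open>\<open>ratio\<close> solved for \<open>\<theta> (r + d)\<close>: the claimed
    bound for an excess \<open>l - r\<close> of exactly \<open>d\<close>.\<close>
  have A: "\<theta> (r + d) \<le> \<alpha> * \<theta> r + \<kappa> * (\<alpha> * \<theta> w - \<theta> d)" if "w \<le> r" for r
    using ratio[OF that] dw unfolding \<kappa>_def by (simp add: field_simps)
  show ?thesis
  proof (cases "w \<le> q")
    case True
    define u where "u = (l - q) / d"
    have u: "0 \<le> u" "u \<le> 1" using q dw by (auto simp: u_def field_simps)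
    have l: "l = u * (q + d) + (1 - u) * q" using dw by (simp add: u_def field_simps)
    have "\<theta> l \<le> u * \<theta> (q + d) + (1 - u) * \<theta> q"
      using convex_combination_le[OF conv, of "q + d" q u] u q dw l by simp
    also have "\<dots> \<le> u * (\<alpha> * \<theta> q + \<kappa> * (\<alpha> * \<theta> w - \<theta> d)) + (1 - u) * (\<alpha> * \<theta> q)"
      using u q True by (intro add_mono mult_left_mono A \<alpha>) auto
    also have "\<dots> = \<alpha> * \<theta> q + (u * \<kappa>) * (\<alpha> * \<theta> w - \<theta> d)" by (simp add: algebra_simps)
    also have "u * \<kappa> = (l - q) / (w - d)" using dw by (simp add: u_def \<kappa>_def)
    finally show ?thesis using True by (simp add: max_def)
  next
    case False
    define u where "u = (l - d) / w"
    have u: "0 \<le> u" "u \<le> 1" using q dw False by (auto simp: u_def field_simps)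
    have l: "l = u * (w + d) + (1 - u) * d" using dw by (simp add: u_def field_simps)
    have "\<theta> l \<le> u * \<theta> (w + d) + (1 - u) * \<theta> d"
      using convex_combination_le[OF conv, of "w + d" d u] u q dw l by simp
    also have "\<dots> \<le> u * (\<alpha> * \<theta> w + \<kappa> * (\<alpha> * \<theta> w - \<theta> d)) + (1 - u) * \<theta> d"
      using u by (intro add_mono mult_left_mono A) auto
    \<comment> \<open>At the left end \<open>d\<close> the claimed bound is an equality:
      \<open>\<theta> d\<close> is \<open>\<alpha> * \<theta> w\<close> minus
      \<open>\<alpha> * \<theta> w - \<theta> d\<close>.\<close>
    also have "\<dots> = \<alpha> * \<theta> w + (u * \<kappa> - (1 - u)) * (\<alpha> * \<theta> w - \<theta> d)"
      by (simp add: algebra_simps)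
    also have "u * \<kappa> - (1 - u) = (l - w) / (w - d)"
    proof -
      have "1 + \<kappa> = w / (w - d)" using dw by (simp add: \<kappa>_def field_simps)
      hence "u * (1 + \<kappa>) = (l - d) / (w - d)" using dw by (simp add: u_def)
      hence "u * \<kappa> - (1 - u) = (l - d) / (w - d) - (w - d) / (w - d)"
        using dw by (simp add: algebra_simps)
      thus ?thesis by (simp only: diff_divide_distrib[symmetric]) simp
    qed
    finally show ?thesis using False by (simp add: max_def)
  qed
qed

lemma EF1_cost_le_water_filling:
  assumes cost: "cost_function \<theta>" and M: "finite M" "M \<noteq> {}" and J: "finite J"
    and pos: "\<forall>j\<in>J. 0 < p j" and fin: "ef1_ratio \<theta> < \<infinity>"
    and ef1: "EF1 J M p \<sigma>"
    and w: "0 \<le> w" "(\<Sum>i\<in>M. max (max_job J p \<sigma> i) w) = (\<Sum>i\<in>M. load J p \<sigma> i)"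
  shows "cost \<theta> J M p \<sigma>
           \<le> enn2real (ef1_ratio \<theta>) * (\<Sum>i\<in>M. \<theta> (max (max_job J p \<sigma> i) w))"
proof -
  let ?\<alpha> = "enn2real (ef1_ratio \<theta>)"
  let ?q = "max_job J p \<sigma>" and ?l = "load J p \<sigma>"
  have nonneg: "\<And>x. 0 \<le> x \<Longrightarrow> 0 \<le> \<theta> x" and zero: "\<theta> 0 = 0" and conv: "convex_on {0..} \<theta>"
    using cost by (auto simp: cost_function_def)
  note ratio = ef1_ratio_bound[of \<theta>, OF nonneg fin]
  have \<alpha>: "\<theta> x \<le> ?\<alpha> * \<theta> x" if "0 \<le> x" for x
    \<comment> \<open>With \<open>d = 0\<close> numerator and denominator agree, so this says
      \<open>\<alpha> \<ge> 1\<close> wherever \<open>\<theta> x > 0\<close>.\<close>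
    using ratio[of "1/2" 0 x] that zero by simp
  note q = max_job_nonneg_le_load[OF J pos, of \<sigma>]
  define d where "d = Min (?l ` M)"
  have d_in: "d \<in> ?l ` M" and d_le: "d \<le> ?l i" if "i \<in> M" for i
    unfolding d_def using M that by (auto intro: Min_in)
  obtain k where k: "k \<in> M" "d = ?l k" using M d_in by blast
  have l_le: "?l i \<le> ?q i + d" if "i \<in> M" for i
    using ef1 k that by (force simp: EF1_def)
  have d0: "0 \<le> d" unfolding k(2) by (rule load_nonneg[OF pos])
  show ?thesis
  proof (cases "0 < d \<and> d < w")
    case True
    hence dw: "0 < d" "d < w" by auto
    have A: "(w - d) * \<theta> (r + d) + d * \<theta> d \<le> ?\<alpha> * ((w - d) * \<theta> r + d * \<theta> w)" if "w \<le> r" for r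
    proof -
      define t where "t = (w - d) / w"
      have t: "0 < t" "t < 1" "1 - t = d / w" using dw by (auto simp: t_def field_simps)
      hence "d / (1 - t) = w" using dw by simp
      hence "w * (t * \<theta> (r + d) + (1 - t) * \<theta> d) \<le> w * (?\<alpha> * (t * \<theta> r + (1 - t) * \<theta> w))"
        using ratio[of t d r] t that dw by (intro mult_left_mono) auto
      moreover have "w * t = w - d" "w * (1 - t) = d" using dw t by (auto simp: t_def)
      ultimately show ?thesis by (metis distrib_left mult.assoc mult.left_commute)
    qed
    let ?c = "?\<alpha> * \<theta> w - \<theta> d"
    have "cost \<theta> J M p \<sigma>
        \<le> (\<Sum>i\<in>M. ?\<alpha> * \<theta> (max (?q i) w) + (?l i - max (?q i) w) / (w - d) * ?c)"
      unfolding cost_def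
      by (intro sum_mono machine_cost_le conv dw A \<alpha> q l_le d_le)
    also have "\<dots> = ?\<alpha> * (\<Sum>i\<in>M. \<theta> (max (?q i) w))
        + ((\<Sum>i\<in>M. ?l i) - (\<Sum>i\<in>M. max (?q i) w)) / (w - d) * ?c"
      by (simp only: sum.distrib sum_distrib_left sum_distrib_right sum_divide_distrib
          sum_subtractf[symmetric])
    finally show ?thesis using w(2) by simp
  next
    case False
    have eq: "?l i = max (?q i) w" if i: "i \<in> M" for i
    proof (cases "d = 0")
      case True
      have "?l i = ?q i" if "i \<in> M" for i using l_le[OF that] q(2)[of i] True by simp
      hence "(\<Sum>i\<in>M. max (?q i) w) = (\<Sum>i\<in>M. ?q i)" using w(2) by simp
      hence "\<forall>i\<in>M. max (?q i) w = ?q i"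
        using sum_mono_inv[of ?q M "\<lambda>i. max (?q i) w"] M by fastforce
      thus ?thesis using \<open>\<And>i. i \<in> M \<Longrightarrow> ?l i = ?q i\<close> i by simp
    next
      case nz: False
      hence "w \<le> d" using False d0 by auto
      hence "max (?q i) w \<le> ?l i" if "i \<in> M" for i using d_le[OF that] q(2)[of i] by simp
      thus ?thesis
        using sum_mono_inv[of "\<lambda>i. max (?q i) w" M ?l, OF w(2)] M i by simp
    qed
    have "cost \<theta> J M p \<sigma> = (\<Sum>i\<in>M. \<theta> (max (?q i) w))"
      unfolding cost_def using eq by simp
    also have "\<dots> \<le> (\<Sum>i\<in>M. ?\<alpha> * \<theta> (max (?q i) w))"
      using w(1) by (intro sum_mono \<alpha>) auto
    finally show ?thesis by (simp add: sum_distrib_left)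
  qed
qed

theorem theorem4:
  fixes \<theta> :: "real \<Rightarrow> real"
    and J :: "'j set" and M :: "'m set"
    and p :: "'j \<Rightarrow> real" and \<sigma> :: "'j \<Rightarrow> 'm"
  assumes "cost_function \<theta>"
    and "finite M" and "finite J"
    and "\<forall>j\<in>J. 0 < p j"
    and "ef1_ratio \<theta> < \<infinity>"
    and "\<sigma> \<in> allocations J M"
    and "EF1 J M p \<sigma>"
  shows "cost \<theta> J M p \<sigma> \<le> enn2real (ef1_ratio \<theta>) * min_cost \<theta> J M p"
proof -
  have "finite (allocations J M)" unfolding allocations_def using assms by (intro finite_PiE) auto
  hence "min_cost \<theta> J M p \<in> cost \<theta> J M p ` allocations J M"
    unfolding min_cost_def using assms(6) by (intro Min_in) auto
  then obtain \<tau> where \<tau>: "\<tau> \<in> allocations J M" "min_cost \<theta> J M p = cost \<theta> J M p \<tau>" by auto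
  show ?thesis
  proof (cases "M = {}")
    case True
    thus ?thesis unfolding \<tau>(2) by (simp add: cost_def)
  next
    case False
    note q = max_job_nonneg_le_load[OF assms(3,4), of \<sigma>]
    have total: "(\<Sum>i\<in>M. load J p \<sigma> i) = (\<Sum>j\<in>J. p j)"
      unfolding load_def using assms by (intro sum_jobs_on)
    have "(\<Sum>i\<in>M. max_job J p \<sigma> i) \<le> (\<Sum>j\<in>J. p j)"
      unfolding total[symmetric] by (intro sum_mono q)
    then obtain w where w: "0 \<le> w" "(\<Sum>i\<in>M. max (max_job J p \<sigma> i) w) = (\<Sum>j\<in>J. p j)"
      using water_level_exists[OF assms(2) False, of "max_job J p \<sigma>"] q(1) by metis
    have "cost \<theta> J M p \<sigma>
        \<le> enn2real (ef1_ratio \<theta>) * (\<Sum>i\<in>M. \<theta> (max (max_job J p \<sigma> i) w))"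
      using assms False w total by (intro EF1_cost_le_water_filling) auto
    also have "\<dots> \<le> enn2real (ef1_ratio \<theta>) * cost \<theta> J M p \<tau>"
      using assms \<tau> w by (intro mult_left_mono cost_ge_water_filling) auto
    finally show ?thesis by (simp add: \<tau>)
  qed
qed

end
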